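(* Let $(a_n)_{n\geq1}$ be a sequence of integers such that for some $t \in \mathbb{N}$ we have $|a_n| \leq n^t$ for all sufficiently large $n$. Assume there exist $\tau \in (0,1)$, reals $1 < B' < B$, and a strictly increasing sequence $(B_L)_{L\geq1}$ of positive integers with $(B')^L \leq B_L \leq B^L$ for all $L$, such that for every $\varepsilon > 0$ there is $L(\varepsilon)$ with $$\int_0^1 \left| \sum_{n=1}^{B_L} e^{2\pi i a_n \alpha} \right| d\alpha > B_L^{\tau - \varepsilon} \qquad \text{for all } L > L(\varepsilon).$$ Then for almost all $\alpha \in [0,1)$ the discrepancy $D_N$ of $(\{a_n\alpha\})_{n\geq1}$ satisfies: for every $\varepsilon>0$ there are infinitely many $N$ with $N D_N > N^{\tau - \varepsilon}$.
   Context: For real $x$, $\{x\}$ denotes the fractional part of $x$. For a sequence $(x_n)_{n\ge1}$ in $[0,1)$, its discrepancy is $$D_N = \sup_{0 \leq a < b \leq 1} \left| \frac{A_N([a,b))}{N} - (b-a) \right|, \qquad A_N([a,b)) = \#\{1 \leq n \leq N : x_n \in [a,b)\}.$$ *)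

theory Defs
  imports "HOL-Analysis.Analysis"
begin

definition count_in :: "(nat \<Rightarrow> real) \<Rightarrow> nat \<Rightarrow> real \<Rightarrow> real \<Rightarrow> nat" where
  "count_in x N a b = card {n \<in> {1..N}. a \<le> x n \<and> x n < b}"

definition discrepancy :: "(nat \<Rightarrow> real) \<Rightarrow> nat \<Rightarrow> real" where
  "discrepancy x N =
     (SUP ab \<in> {(a, b). 0 \<le> a \<and> a < b \<and> b \<le> (1::real)}.
        \<bar>real (count_in x N (fst ab) (snd ab)) / real N - (snd ab - fst ab)\<bar>)"

end

theory Submission
  imports Defs "HOL-Computational_Algebra.Primes" "HOL-Library.Discrete_Functions"
    "HOL-Real_Asymp.Real_Asymp"
begin

text \<open>
  Let \<open>S(x) = \<Sum>n\<le>N. e(a\<^sub>n x)\<close> with \<open>N = B\<^sub>L\<close>. Koksma's inequality for \<open>u \<mapsto> e(h u)\<close> gives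
  \<open>|S(h\<alpha>)| \<le> 2\<pi> h N D\<^sub>N(\<alpha>)\<close>, so it suffices to find a small \<open>h\<close> for which \<open>|S(h\<alpha>)|\<close> is large.
  By dyadic pigeonholing there is a level \<open>y\<close> such that the set where \<open>|S| \<ge> y\<close> has measure \<open>\<mu>\<close>
  with \<open>y\<mu>\<close> at least \<open>\<integral>|S|\<close> up to a logarithm. For \<open>\<alpha>\<close> off a small set this set is hit by \<open>h\<alpha>\<close> for
  some \<open>h \<le> H\<close>, where \<open>H\<close> is slightly larger than \<open>1/\<mu>\<close>: replace the indicator of the set by the
  trigonometric polynomial \<open>\<phi> = 1 - (1 - (|S|/N)\<^bsup>2r\<^esup>)\<^bsup>d\<^esup>\<close> with \<open>d \<approx> (N/y)\<^bsup>2r\<^esup>\<close>, whose degree is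
  polynomial in \<open>N\<close> because of the growth condition. A frequency of polynomial size has only
  \<open>N\<^bsup>o(1)\<^esup>\<close> divisors, so the variance of \<open>\<Sum>h\<le>H. \<phi>(h\<alpha>)\<close> is at most \<open>N\<^bsup>o(1)\<^esup>\<close> times its mean, and
  Chebyshev's inequality applies. Then \<open>N D\<^sub>N(\<alpha>)\<close> is essentially at least \<open>y/H \<approx> y\<mu>\<close>. As \<open>B\<^sub>L\<close> grows
  exponentially, the exceptional sets have summable measures, and the Borel--Cantelli lemma concludes.
\<close>

section \<open>Exceptional sets and level sets\<close>

definition holds_except :: "'a measure \<Rightarrow> real \<Rightarrow> ('a \<Rightarrow> bool) \<Rightarrow> bool" where
  "holds_except M c P \<longleftrightarrow> (\<exists>E\<in>sets M. measure M E \<le> c \<and> (\<forall>x\<in>space M - E. P x))"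

lemma holds_except_mono:
  assumes "holds_except M c P" "c \<le> c'" "\<And>x. x \<in> space M \<Longrightarrow> P x \<Longrightarrow> Q x"
  shows "holds_except M c' Q"
  using assms unfolding holds_except_def by (meson DiffD1 order.trans)

lemma (in finite_measure) holds_except_second_moment:
  fixes f :: "'a \<Rightarrow> real"
  assumes [measurable]: "f \<in> borel_measurable M"
    and "integrable M (\<lambda>x. (f x)\<^sup>2)" "a > 0"
  shows "holds_except M ((\<integral>x. (f x)\<^sup>2 \<partial>M) / a\<^sup>2) (\<lambda>x. \<bar>f x\<bar> < a)"
  unfolding holds_except_def
proof (intro bexI conjI ballI)
  show "measure M {x \<in> space M. a \<le> \<bar>f x\<bar>} \<le> (\<integral>x. (f x)\<^sup>2 \<partial>M) / a\<^sup>2"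
    using assms by (rule second_moment_method)
qed auto

lemma (in finite_measure) AE_eventually_of_holds_except:
  assumes ev: "\<forall>\<^sub>F n in sequentially. holds_except M (c n) (P n)" and c: "summable c"
  shows "AE x in M. \<forall>\<^sub>F n in sequentially. P n x"
proof -
  obtain n0 where "\<And>n. n \<ge> n0 \<Longrightarrow> holds_except M (c n) (P n)"
    using ev by (auto simp: eventually_sequentially)
  then obtain E where E: "\<And>n. n \<ge> n0 \<Longrightarrow> E n \<in> sets M" "\<And>n. n \<ge> n0 \<Longrightarrow> measure M (E n) \<le> c n"
      "\<And>n x. n \<ge> n0 \<Longrightarrow> x \<in> space M - E n \<Longrightarrow> P n x"
    unfolding holds_except_def by metis
  have "AE x in M. \<forall>\<^sub>F n in sequentially. x \<in> space M - E (n + n0)"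
  proof (rule borel_cantelli_AE1)
    have "summable (\<lambda>n. c (n + n0))" using c by simp
    then show "summable (\<lambda>n. measure M (E (n + n0)))"
      by (rule summable_comparison_test'[where N = 0]) (simp add: E(2))
  qed (use E(1) emeasure_finite in \<open>auto simp: less_top[symmetric]\<close>)
  then show ?thesis
  proof eventually_elim
    case (elim x)
    then have "\<forall>\<^sub>F n in sequentially. P (n + n0) x"
      by eventually_elim (simp add: E(3))
    then show ?case using eventually_sequentially_seg[of "\<lambda>n. P n x" n0] by blast
  qed
qed

lemma le_sum_dyadic_levels:
  fixes y :: real
  assumes "y < 2 ^ n"
  shows "y \<le> 1 + (\<Sum>k<n. if 2 ^ k \<le> y then 2 ^ k else 0)"
  using assms
proof (induction n)
  case 0
  then show ?case by simp
next
  case (Suc n)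
  show ?case
  proof (cases "2 ^ n \<le> y")
    case True
    have "2 ^ k \<le> y" if "k < Suc n" for k
      by (rule order.trans[OF power_increasing True]) (use that in auto)
    then have "(\<Sum>k<Suc n. if 2 ^ k \<le> y then 2 ^ k else 0 :: real) = (\<Sum>k<Suc n. 2 ^ k)"
      by (intro sum.cong) auto
    also have "\<dots> = 2 ^ Suc n - 1"
      using sum_gp_strict[of "2::real" "Suc n"] by simp
    finally show ?thesis using Suc.prems by simp
  qed (use Suc.IH in simp)
qed

lemma (in finite_measure) exists_dyadic_level:
  fixes f :: "'a \<Rightarrow> real"
  assumes f: "integrable M f" and "0 < n" and ub: "\<And>x. x \<in> space M \<Longrightarrow> f x < 2 ^ n"
  shows "\<exists>k<n. (\<integral>x. f x \<partial>M) - measure M (space M)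
            \<le> real n * (2 ^ k * measure M {x \<in> space M. 2 ^ k \<le> f x})"
proof (rule ccontr)
  assume few: "\<not> ?thesis"
  define E where "E k = {x \<in> space M. 2 ^ k \<le> f x}" for k :: nat
  have [measurable]: "f \<in> borel_measurable M" using f by simp
  have [measurable]: "E k \<in> sets M" for k unfolding E_def by measurable
  have int_E: "integrable M (\<lambda>x. 2 ^ k * indicator (E k) x :: real)" for k
    using emeasure_finite[of "E k"] by (simp add: less_top[symmetric])
  have "(\<integral>x. f x \<partial>M) \<le> (\<integral>x. 1 + (\<Sum>k<n. 2 ^ k * indicator (E k) x) \<partial>M)"
  proof (rule integral_mono[OF f])
    fix x assume x: "x \<in> space M"
    have "f x \<le> 1 + (\<Sum>k<n. if 2 ^ k \<le> f x then 2 ^ k else 0)"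
      by (rule le_sum_dyadic_levels[OF ub[OF x]])
    also have "(\<Sum>k<n. if 2 ^ k \<le> f x then 2 ^ k else 0 :: real) = (\<Sum>k<n. 2 ^ k * indicator (E k) x)"
      using x by (intro sum.cong) (auto simp: E_def indicator_def)
    finally show "f x \<le> 1 + (\<Sum>k<n. 2 ^ k * indicator (E k) x)" .
  qed (intro Bochner_Integration.integrable_add Bochner_Integration.integrable_sum int_E, simp)
  also have "\<dots> = measure M (space M) + (\<Sum>k<n. 2 ^ k * measure M (E k))"
  proof -
    have "(\<integral>x. 1 + (\<Sum>k<n. 2 ^ k * indicator (E k) x :: real) \<partial>M)
        = (\<integral>x. 1 \<partial>M) + (\<Sum>k<n. \<integral>x. 2 ^ k * indicator (E k) x \<partial>M)"
      using int_E by (simp only: Bochner_Integration.integral_add Bochner_Integration.integral_sum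
        Bochner_Integration.integrable_sum integrable_const)
    moreover have "E k \<inter> space M = E k" for k by (auto simp: E_def)
    ultimately show ?thesis by simp
  qed
  finally have "(\<integral>x. f x \<partial>M) - measure M (space M) \<le> (\<Sum>k<n. 2 ^ k * measure M (E k))"
    by simp
  also have "\<dots> < (\<Sum>k<n. ((\<integral>x. f x \<partial>M) - measure M (space M)) / real n)"
    using few \<open>0 < n\<close> by (intro sum_strict_mono) (auto simp: E_def field_simps not_le)
  finally show False using \<open>0 < n\<close> by simp
qed

section \<open>The character of the circle\<close>

definition circle_char :: "real \<Rightarrow> complex" where
  "circle_char x = cis (2 * pi * x)"

lemma norm_circle_char [simp]: "norm (circle_char x) = 1"
  by (simp add: circle_char_def)

lemma circle_char_0 [simp]: "circle_char 0 = 1"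
  by (simp add: circle_char_def)

lemma circle_char_of_int [simp]: "circle_char (of_int k) = 1"
  by (simp add: circle_char_def)

lemma circle_char_add: "circle_char (x + y) = circle_char x * circle_char y"
  by (simp add: circle_char_def cis_mult distrib_left)

lemma cnj_circle_char: "cnj (circle_char x) = circle_char (- x)"
  by (simp add: circle_char_def cis_cnj)

lemma circle_char_of_int_mult_frac: "circle_char (of_int k * frac x) = circle_char (of_int k * x)"
proof -
  have "of_int k * x = of_int k * frac x + of_int (k * \<lfloor>x\<rfloor>)"
    by (simp add: frac_def algebra_simps)
  then show ?thesis
    by (simp only: circle_char_add circle_char_of_int mult_1_right)
qed

lemma continuous_on_circle_char [continuous_intros]:
  "continuous_on A f \<Longrightarrow> continuous_on A (\<lambda>x. circle_char (f x))"
  unfolding circle_char_def by (intro continuous_intros) auto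

lemma circle_char_has_vector_derivative:
  "((\<lambda>x. circle_char (c * x)) has_vector_derivative (2 * pi * \<i> * c * circle_char (c * x))) (at x within A)"
proof -
  have "((\<lambda>x. exp (\<i> * of_real (2 * pi * c) * x)) has_field_derivative
      (\<i> * of_real (2 * pi * c) * exp (\<i> * of_real (2 * pi * c) * of_real x))) (at (of_real x))"
    by (auto intro!: derivative_eq_intros)
  from has_vector_derivative_real_field[OF this] show ?thesis
    by (simp add: circle_char_def cis_conv_exp mult_ac)
qed

lemma has_integral_circle_char:
  assumes "k \<noteq> 0"
  shows "((\<lambda>x. circle_char (of_int k * x)) has_integral 0) {0..1}"
proof -
  define F where "F x = circle_char (of_int k * x) / (2 * pi * \<i> * of_int k)" for x
  have "(F has_vector_derivative circle_char (of_int k * x)) (at x within {0..1})" for x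
    using assms has_vector_derivative_divide
      [OF circle_char_has_vector_derivative[of "of_int k" x "{0..1}"], of "2 * pi * \<i> * of_int k"]
    unfolding F_def by simp
  then have "((\<lambda>x. circle_char (of_int k * x)) has_integral (F 1 - F 0)) {0..1}"
    by (intro fundamental_theorem_of_calculus) auto
  then show ?thesis using circle_char_of_int[of k] by (simp add: F_def)
qed

section \<open>Koksma's inequality\<close>

lemma abs_count_in_diff_le_discrepancy:
  assumes "0 \<le> a" "a < b" "b \<le> 1"
  shows "\<bar>real (count_in x N a b) - real N * (b - a)\<bar> \<le> real N * discrepancy x N"
proof (cases "N = 0")
  case False
  define dev where "dev ab = \<bar>real (count_in x N (fst ab) (snd ab)) / real N - (snd ab - fst ab)\<bar>"
    for ab
  have "dev (c, d) \<le> 2" if "0 \<le> c" "c < d" "d \<le> 1" for c d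
  proof -
    have "count_in x N c d \<le> card {1..N}" unfolding count_in_def by (intro card_mono) auto
    then have "0 \<le> real (count_in x N c d) / real N" "real (count_in x N c d) / real N \<le> 1"
      using False by simp_all
    then show ?thesis unfolding dev_def fst_conv snd_conv using that by linarith
  qed
  then have "bdd_above (dev ` {(c, d). 0 \<le> c \<and> c < d \<and> d \<le> 1})"
    by (intro bdd_aboveI2[where M = 2]) auto
  then have "dev (a, b) \<le> discrepancy x N"
    unfolding discrepancy_def dev_def[symmetric] using assms by (intro cSUP_upper) auto
  then have "real N * dev (a, b) \<le> real N * discrepancy x N"
    by (rule mult_left_mono) simp
  moreover have "real N * dev (a, b) = \<bar>real N * (real (count_in x N a b) / real N - (b - a))\<bar>"
    by (simp add: dev_def abs_mult)
  ultimately show ?thesis using False by (simp add: right_diff_distrib)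
qed (simp add: count_in_def)

lemma of_nat_mult_discrepancy_nonneg: "0 \<le> real N * discrepancy x N"
  using abs_count_in_diff_le_discrepancy[of 0 1 x N] by (simp add: order.trans[OF abs_ge_zero])

lemma koksma_kernel_has_integral:
  fixes f :: "real \<Rightarrow> 'a::banach"
  assumes deriv: "\<And>u. u \<in> {0..1} \<Longrightarrow> (f has_vector_derivative f' u) (at u within {0..1})"
    and c: "c \<in> {0..1}"
  shows "((\<lambda>u. (of_bool (c < u) - u) *\<^sub>R f' u) has_integral (integral {0..1} f - f c)) {0..1}"
proof -
  have "(f' has_integral (f 1 - f c)) {c..1}"
    using c by (intro fundamental_theorem_of_calculus)
      (auto intro: has_vector_derivative_within_subset[OF deriv])
  then have "((\<lambda>u. if u \<in> {c..1} then f' u else 0) has_integral (f 1 - f c)) {0..1}"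
    using c by (subst has_integral_restrict) auto
  then have jump: "((\<lambda>u. of_bool (c < u) *\<^sub>R f' u) has_integral (f 1 - f c)) {0..1}"
    by (rule has_integral_spike_finite[of "{c}", rotated 2]) auto
  have deriv_prod: "((\<lambda>u. u *\<^sub>R f' u + 1 *\<^sub>R f u) has_integral (1 *\<^sub>R f 1 - 0 *\<^sub>R f 0)) {0..1}"
    by (intro fundamental_theorem_of_calculus has_vector_derivative_scaleR DERIV_ident deriv) auto
  have "continuous_on {0..1} f"
    using deriv has_vector_derivative_continuous continuous_on_eq_continuous_within by blast
  then have "(f has_integral integral {0..1} f) {0..1}"
    by (intro integrable_integral integrable_continuous_interval)
  from has_integral_diff[OF deriv_prod this]
  have "((\<lambda>u. u *\<^sub>R f' u) has_integral (f 1 - integral {0..1} f)) {0..1}"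
    by simp
  from has_integral_diff[OF jump this] show ?thesis
    by (simp add: scaleR_diff_left)
qed

theorem koksma_inequality:
  fixes f :: "real \<Rightarrow> 'a::banach"
  assumes x: "\<And>n. n \<in> {1..N} \<Longrightarrow> x n \<in> {0..<1}"
    and deriv: "\<And>u. u \<in> {0..1} \<Longrightarrow> (f has_vector_derivative f' u) (at u within {0..1})"
    and cont: "continuous_on {0..1} f'"
  shows "norm ((\<Sum>n=1..N. f (x n)) - real N *\<^sub>R integral {0..1} f)
      \<le> real N * discrepancy x N * integral {0..1} (\<lambda>u. norm (f' u))"
proof -
  define k where "k u = (\<Sum>n=1..N. (of_bool (x n < u) - u) *\<^sub>R f' u)" for u
  have k_int: "(k has_integral (\<Sum>n=1..N. integral {0..1} f - f (x n))) {0..1}"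
    unfolding k_def
    by (intro has_integral_sum koksma_kernel_has_integral deriv) (use x in \<open>auto intro: less_imp_le\<close>)
  have k_le: "norm (k u) \<le> real N * discrepancy x N * norm (f' u)" if u: "u \<in> {0..1}" for u
  proof -
    have "{n \<in> {1..N}. 0 \<le> x n \<and> x n < u} = {1..N} \<inter> {n. x n < u}" using x by auto
    then have count: "(\<Sum>n=1..N. of_bool (x n < u) - u) = real (count_in x N 0 u) - real N * u"
      by (simp add: count_in_def sum_subtractf of_bool_def sum.If_cases)
    have "\<bar>real (count_in x N 0 u) - real N * u\<bar> \<le> real N * discrepancy x N"
    proof (cases "u = 0")
      case True
      then have "count_in x N 0 u = 0" by (auto simp: count_in_def)
      then show ?thesis using True of_nat_mult_discrepancy_nonneg[of N x] by simp
    next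
      case False
      then show ?thesis using u abs_count_in_diff_le_discrepancy[of 0 u x N] by simp
    qed
    then show ?thesis
      unfolding k_def scaleR_sum_left[symmetric] count norm_scaleR by (rule mult_right_mono) simp
  qed
  have "norm (integral {0..1} k) \<le> integral {0..1} (\<lambda>u. real N * discrepancy x N * norm (f' u))"
    by (intro integral_norm_bound_integral k_le has_integral_integrable[OF k_int]
        integrable_continuous_interval continuous_intros cont)
  moreover have "integral {0..1} k = real N *\<^sub>R integral {0..1} f - (\<Sum>n=1..N. f (x n))"
    using integral_unique[OF k_int] by (simp add: sum_subtractf sum_constant_scaleR)
  ultimately show ?thesis by (simp add: norm_minus_commute)
qed

definition weyl_sum :: "(nat \<Rightarrow> int) \<Rightarrow> nat \<Rightarrow> real \<Rightarrow> complex" where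
  "weyl_sum a N x = (\<Sum>n=1..N. circle_char (of_int (a n) * x))"

lemma norm_weyl_sum_le: "norm (weyl_sum a N x) \<le> real N"
  unfolding weyl_sum_def
  using norm_sum[of "\<lambda>n. circle_char (of_int (a n) * x)" "{1..N}"] by simp

lemma norm_weyl_sum_dilate_le_discrepancy:
  assumes "h > 0"
  shows "norm (weyl_sum a N (real h * x))
      \<le> 2 * pi * real h * (real N * discrepancy (\<lambda>n. frac (of_int (a n) * x)) N)"
proof -
  define f f' where "f u = circle_char (real h * u)"
    and "f' u = 2 * pi * \<i> * h * circle_char (real h * u)" for u
  have "f (frac (of_int (a n) * x)) = circle_char (of_int (a n) * (real h * x))" for n
    using circle_char_of_int_mult_frac[of "int h" "of_int (a n) * x"] by (simp add: f_def mult_ac)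
  then have sum: "weyl_sum a N (real h * x) = (\<Sum>n=1..N. f (frac (of_int (a n) * x)))"
    by (simp add: weyl_sum_def)
  have mean: "integral {0..1} f = 0"
    using has_integral_circle_char[of "int h"] assms by (simp add: f_def[abs_def] integral_unique)
  have variation: "integral {0..1} (\<lambda>u. norm (f' u)) = 2 * pi * real h"
    by (simp add: f'_def norm_mult)
  have "norm ((\<Sum>n=1..N. f (frac (of_int (a n) * x))) - real N *\<^sub>R integral {0..1} f)
      \<le> real N * discrepancy (\<lambda>n. frac (of_int (a n) * x)) N * integral {0..1} (\<lambda>u. norm (f' u))"
  proof (rule koksma_inequality)
    show "(f has_vector_derivative f' u) (at u within {0..1})" for u
      using circle_char_has_vector_derivative[of "real h"] by (simp add: f_def[abs_def] f'_def)
    show "continuous_on {0..1} f'"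
      unfolding f'_def by (intro continuous_intros)
  qed (use frac_lt_1 in auto)
  then show ?thesis unfolding sum mean variation by (simp add: mult_ac)
qed

section \<open>Mean squares of exponential sums\<close>

abbreviation unit_lborel :: "real measure" where
  "unit_lborel \<equiv> restrict_space lborel {0..1}"

lemma space_unit_lborel [simp]: "space unit_lborel = {0..1}"
  by (simp add: space_restrict_space)

lemma measure_unit_lborel_space [simp]: "measure unit_lborel {0..1} = 1"
  by (simp add: measure_restrict_space)

interpretation unit_lborel: finite_measure unit_lborel
  by (rule finite_measureI) (simp add: emeasure_restrict_space)

lemma set_integrable_continuous_on_unit:
  fixes f :: "real \<Rightarrow> 'a::{banach, second_countable_topology}"
  assumes "continuous_on {0..1} f"
  shows "set_integrable lborel {0..1} f"
  unfolding set_integrable_def by (rule borel_integrable_compact) (use assms in auto)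

lemma integrable_unit_lborel:
  fixes f :: "real \<Rightarrow> 'a::{banach, second_countable_topology}"
  assumes "continuous_on {0..1} f"
  shows "integrable unit_lborel f"
  using set_integrable_continuous_on_unit[OF assms]
  by (simp add: integrable_restrict_space set_integrable_def)

lemma lebesgue_integral_unit_lborel:
  fixes f :: "real \<Rightarrow> 'a::{banach, second_countable_topology}"
  shows "(LINT x|unit_lborel. f x) = (LINT x:{0..1}|lborel. f x)"
  by (simp add: integral_restrict_space set_lebesgue_integral_def)

lemma lebesgue_integral_circle_char:
  "(LINT x|unit_lborel. circle_char (of_int k * x)) = (if k = 0 then 1 else 0)"
proof (cases "k = 0")
  case False
  have "set_integrable lborel {0..1} (\<lambda>x. circle_char (of_int k * x))"
    by (intro set_integrable_continuous_on_unit continuous_intros)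
  from set_borel_integral_eq_integral(2)[OF this] show ?thesis
    using False has_integral_circle_char[OF False]
    by (simp add: lebesgue_integral_unit_lborel integral_unique)
qed simp

lemma parseval_circle_char:
  fixes c :: "int \<Rightarrow> complex"
  assumes "finite V"
  shows "(LINT x|unit_lborel. (norm (\<Sum>k\<in>V. c k * circle_char (of_int k * x)))\<^sup>2) = (\<Sum>k\<in>V. (norm (c k))\<^sup>2)"
    (is "(LINT x|_. (norm (?f x))\<^sup>2) = _")
proof -
  have expand: "complex_of_real ((norm (?f x))\<^sup>2)
      = (\<Sum>k\<in>V. \<Sum>l\<in>V. c k * cnj (c l) * circle_char (of_int (k - l) * x))" for x
  proof -
    have "circle_char (of_int (k - l) * x) = circle_char (of_int k * x) * cnj (circle_char (of_int l * x))" for k l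
      by (simp add: cnj_circle_char circle_char_add[symmetric] algebra_simps)
    then show ?thesis
      by (simp add: complex_norm_square sum_product mult_ac del: of_int_diff of_real_power)
  qed
  have int: "integrable unit_lborel (\<lambda>x. c k * cnj (c l) * circle_char (of_int (k - l) * x))" for k l
    by (intro integrable_unit_lborel continuous_intros)
  have "complex_of_real (LINT x|unit_lborel. (norm (?f x))\<^sup>2)
      = (LINT x|unit_lborel. (\<Sum>k\<in>V. \<Sum>l\<in>V. c k * cnj (c l) * circle_char (of_int (k - l) * x)))"
    by (simp only: integral_complex_of_real[symmetric] expand)
  also have "\<dots> = (\<Sum>k\<in>V. \<Sum>l\<in>V. LINT x|unit_lborel. c k * cnj (c l) * circle_char (of_int (k - l) * x))"
    by (simp only: Bochner_Integration.integral_sum Bochner_Integration.integrable_sum int)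
  also have "\<dots> = (\<Sum>k\<in>V. \<Sum>l\<in>V. if l = k then c k * cnj (c l) else 0)"
    unfolding integral_mult_right_zero lebesgue_integral_circle_char by (intro sum.cong) auto
  also have "\<dots> = complex_of_real (\<Sum>k\<in>V. (norm (c k))\<^sup>2)"
    using assms by (simp add: complex_norm_square del: of_real_power)
  finally show ?thesis by (simp only: of_real_eq_iff)
qed

lemma mean_square_exp_sum_le:
  fixes w :: "'i \<Rightarrow> complex" and v :: "'i \<Rightarrow> int" and W :: real
  assumes fin: "finite I" and mult: "\<And>k. k \<in> v ` I \<Longrightarrow> real (card {i\<in>I. v i = k}) \<le> W"
  shows "(LINT x|unit_lborel. (norm (\<Sum>i\<in>I. w i * circle_char (of_int (v i) * x)))\<^sup>2)
      \<le> W * (\<Sum>i\<in>I. (norm (w i))\<^sup>2)"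
proof -
  define c where "c k = (\<Sum>i\<in>{i\<in>I. v i = k}. w i)" for k
  have "(\<Sum>i\<in>I. w i * circle_char (of_int (v i) * x)) = (\<Sum>k\<in>v ` I. c k * circle_char (of_int k * x))" for x
    unfolding sum.image_gen[OF fin, of _ v] c_def by (auto simp: sum_distrib_right intro!: sum.cong)
  then have "(LINT x|unit_lborel. (norm (\<Sum>i\<in>I. w i * circle_char (of_int (v i) * x)))\<^sup>2)
      = (\<Sum>k\<in>v ` I. (norm (c k))\<^sup>2)"
    using fin by (simp add: parseval_circle_char)
  also have "\<dots> \<le> (\<Sum>k\<in>v ` I. W * (\<Sum>i\<in>{i\<in>I. v i = k}. (norm (w i))\<^sup>2))"
  proof (intro sum_mono)
    fix k assume k: "k \<in> v ` I"
    have "(norm (c k))\<^sup>2 \<le> (\<Sum>i\<in>{i\<in>I. v i = k}. norm (w i))\<^sup>2"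
      unfolding c_def by (intro power_mono norm_sum) simp
    also have "\<dots> \<le> (\<Sum>i\<in>{i\<in>I. v i = k}. (norm (w i))\<^sup>2) * real (card {i\<in>I. v i = k})"
      by (rule sum_squared_le_sum_of_squares)
    also have "\<dots> \<le> (\<Sum>i\<in>{i\<in>I. v i = k}. (norm (w i))\<^sup>2) * W"
      by (intro mult_left_mono mult[OF k] sum_nonneg) auto
    finally show "(norm (c k))\<^sup>2 \<le> W * (\<Sum>i\<in>{i\<in>I. v i = k}. (norm (w i))\<^sup>2)"
      by (simp add: mult.commute)
  qed
  also have "\<dots> = W * (\<Sum>i\<in>I. (norm (w i))\<^sup>2)"
    by (simp add: sum_distrib_left[symmetric] sum.image_gen[OF fin, of _ v, symmetric])
  finally show ?thesis .
qed

section \<open>Trigonometric polynomials and their dilates\<close>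

definition trig_poly :: "nat \<Rightarrow> (real \<Rightarrow> complex) \<Rightarrow> bool" where
  "trig_poly J f \<longleftrightarrow> (\<exists>c. \<forall>x. f x = (\<Sum>j\<in>{-int J..int J}. c j * circle_char (of_int j * x)))"

lemma trig_poly_circle_char:
  assumes "\<bar>k\<bar> \<le> int J"
  shows "trig_poly J (\<lambda>x. circle_char (of_int k * x))"
proof -
  have "circle_char (of_int k * x)
      = (\<Sum>j\<in>{-int J..int J}. (if j = k then 1 else 0) * circle_char (of_int j * x))" for x
    using assms by (simp add: if_distrib[of "\<lambda>a. a * _"] abs_le_iff cong: if_cong)
  then show ?thesis unfolding trig_poly_def
    by (intro exI[of _ "\<lambda>j. if j = k then 1 else 0"]) blast
qed

lemma trig_poly_add:
  assumes "trig_poly J f" "trig_poly J g"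
  shows "trig_poly J (\<lambda>x. f x + g x)"
proof -
  obtain c d where "\<And>x. f x = (\<Sum>j\<in>{-int J..int J}. c j * circle_char (of_int j * x))"
     "\<And>x. g x = (\<Sum>j\<in>{-int J..int J}. d j * circle_char (of_int j * x))"
    using assms by (auto simp: trig_poly_def)
  then show ?thesis unfolding trig_poly_def
    by (intro exI[of _ "\<lambda>j. c j + d j"]) (simp add: sum.distrib distrib_right)
qed

lemma trig_poly_const_mult:
  assumes "trig_poly J f"
  shows "trig_poly J (\<lambda>x. a * f x)"
proof -
  obtain c where "\<And>x. f x = (\<Sum>j\<in>{-int J..int J}. c j * circle_char (of_int j * x))"
    using assms by (auto simp: trig_poly_def)
  then show ?thesis unfolding trig_poly_def
    by (intro exI[of _ "\<lambda>j. a * c j"]) (simp add: sum_distrib_left mult_ac)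
qed

lemma trig_poly_const: "trig_poly J (\<lambda>x. a)"
  using trig_poly_const_mult[OF trig_poly_circle_char[of 0 J], of a] by simp

lemma trig_poly_diff:
  assumes "trig_poly J f" "trig_poly J g"
  shows "trig_poly J (\<lambda>x. f x - g x)"
  using trig_poly_add[OF assms(1) trig_poly_const_mult[OF assms(2), of "-1"]] by simp

lemma trig_poly_sum:
  assumes "\<And>i. i \<in> I \<Longrightarrow> trig_poly J (f i)"
  shows "trig_poly J (\<lambda>x. \<Sum>i\<in>I. f i x)"
  using assms
  by (induction I rule: infinite_finite_induct) (auto intro: trig_poly_add trig_poly_const)

lemma trig_poly_mult:
  assumes "trig_poly J f" "trig_poly K g"
  shows "trig_poly (J + K) (\<lambda>x. f x * g x)"
proof -
  obtain c d where c: "\<And>x. f x = (\<Sum>j\<in>{-int J..int J}. c j * circle_char (of_int j * x))"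
     and d: "\<And>x. g x = (\<Sum>j\<in>{-int K..int K}. d j * circle_char (of_int j * x))"
    using assms by (auto simp: trig_poly_def)
  have "f x * g x
      = (\<Sum>j\<in>{-int J..int J}. \<Sum>k\<in>{-int K..int K}. (c j * d k) * circle_char (of_int (j + k) * x))" for x
    unfolding c d sum_product by (intro sum.cong) (auto simp: distrib_right circle_char_add)
  moreover have "trig_poly (J + K) (\<lambda>x. \<Sum>j\<in>{-int J..int J}. \<Sum>k\<in>{-int K..int K}.
      (c j * d k) * circle_char (of_int (j + k) * x))"
    by (intro trig_poly_sum trig_poly_const_mult trig_poly_circle_char) auto
  ultimately show ?thesis by simp
qed

lemma trig_poly_power:
  assumes "trig_poly J f"
  shows "trig_poly (n * J) (\<lambda>x. f x ^ n)"
  by (induction n) (use trig_poly_mult[OF assms] in \<open>auto intro: trig_poly_const\<close>)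

lemma trig_poly_cnj:
  assumes "trig_poly J f"
  shows "trig_poly J (\<lambda>x. cnj (f x))"
proof -
  obtain c where "\<And>x. f x = (\<Sum>j\<in>{-int J..int J}. c j * circle_char (of_int j * x))"
    using assms by (auto simp: trig_poly_def)
  then have "cnj (f x) = (\<Sum>j\<in>{-int J..int J}. cnj (c j) * circle_char (of_int (-j) * x))" for x
    by (simp add: cnj_circle_char)
  moreover have "trig_poly J (\<lambda>x. \<Sum>j\<in>{-int J..int J}. cnj (c j) * circle_char (of_int (-j) * x))"
    by (intro trig_poly_sum trig_poly_const_mult trig_poly_circle_char) auto
  ultimately show ?thesis by simp
qed

lemma trig_poly_continuous_on:
  assumes "trig_poly J f"
  shows "continuous_on A f"
proof -
  obtain c where "f = (\<lambda>x. \<Sum>j\<in>{-int J..int J}. c j * circle_char (of_int j * x))"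
    using assms by (auto simp: trig_poly_def fun_eq_iff)
  then show ?thesis by (simp only:) (intro continuous_intros)
qed

lemma trig_poly_fourier_expansion:
  assumes "trig_poly J f"
  obtains c where "\<And>x. f x = (\<Sum>j\<in>{-int J..int J}. c j * circle_char (of_int j * x))"
    and "(LINT x|unit_lborel. f x) = c 0"
    and "(LINT x|unit_lborel. (norm (f x))\<^sup>2) = (\<Sum>j\<in>{-int J..int J}. (norm (c j))\<^sup>2)"
proof -
  obtain c where c: "\<And>x. f x = (\<Sum>j\<in>{-int J..int J}. c j * circle_char (of_int j * x))"
    using assms by (auto simp: trig_poly_def)
  have "(LINT x|unit_lborel. f x) = (\<Sum>j\<in>{-int J..int J}. LINT x|unit_lborel. c j * circle_char (of_int j * x))"
    unfolding c by (intro Bochner_Integration.integral_sum integrable_unit_lborel continuous_intros)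
  also have "\<dots> = (\<Sum>j\<in>{-int J..int J}. if j = 0 then c j else 0)"
    unfolding integral_mult_right_zero lebesgue_integral_circle_char by (intro sum.cong) auto
  finally have "(LINT x|unit_lborel. f x) = c 0" by simp
  then show thesis using c that by (simp add: parseval_circle_char)
qed

lemma card_factorizations_le:
  fixes P :: "nat set" and Z :: "int set" and v :: int
  assumes "finite P" "v \<noteq> 0"
  shows "card {i \<in> P \<times> Z. int (fst i) * snd i = v} \<le> card {h \<in> P. h dvd nat \<bar>v\<bar>}"
proof (rule card_inj_on_le[where f = fst])
  show "inj_on fst {i \<in> P \<times> Z. int (fst i) * snd i = v}"
    using assms(2) by (auto simp: inj_on_def)
  have "h dvd nat \<bar>int h * j\<bar>" for h j
    by (simp add: nat_abs_mult_distrib)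
  then show "fst ` {i \<in> P \<times> Z. int (fst i) * snd i = v} \<subseteq> {h \<in> P. h dvd nat \<bar>v\<bar>}"
    by auto
qed (use assms in simp)

lemma mean_square_dilates_le:
  fixes f :: "real \<Rightarrow> complex" and P :: "nat set" and W :: real
  assumes f: "trig_poly J f" and P: "P \<subseteq> {1..H}" and W: "0 \<le> W"
    and divisors: "\<And>n. 0 < n \<Longrightarrow> n \<le> J * H \<Longrightarrow> real (card {h \<in> P. h dvd n}) \<le> W"
  shows "(LINT x|unit_lborel. (norm ((\<Sum>h\<in>P. f (real h * x)) - of_nat (card P) * (LINT x|unit_lborel. f x)))\<^sup>2)
      \<le> W * (real (card P) * (LINT x|unit_lborel. (norm (f x))\<^sup>2))"
proof -
  obtain c where c: "\<And>x. f x = (\<Sum>j\<in>{-int J..int J}. c j * circle_char (of_int j * x))"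
    and mean: "(LINT x|unit_lborel. f x) = c 0"
    and parseval: "(LINT x|unit_lborel. (norm (f x))\<^sup>2) = (\<Sum>j\<in>{-int J..int J}. (norm (c j))\<^sup>2)"
    using trig_poly_fourier_expansion[OF f] by blast
  have fin: "finite P" using P finite_subset by blast
  define Z where "Z = {-int J..int J} - {0}"
  have Z: "{-int J..int J} = insert 0 Z" "finite Z" "0 \<notin> Z" by (auto simp: Z_def)
  have "f (real h * x) - c 0 = (\<Sum>j\<in>Z. c j * circle_char (of_int (int h * j) * x))" for h x
    unfolding c Z(1) using Z by (simp add: mult_ac)
  then have "(\<Sum>h\<in>P. f (real h * x) - c 0)
      = (\<Sum>i\<in>P \<times> Z. c (snd i) * circle_char (of_int (int (fst i) * snd i) * x))" for x
    by (simp add: sum.cartesian_product case_prod_unfold)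
  then have expand: "(\<Sum>h\<in>P. f (real h * x)) - of_nat (card P) * c 0
      = (\<Sum>i\<in>P \<times> Z. c (snd i) * circle_char (of_int (int (fst i) * snd i) * x))" for x
    by (simp add: sum_subtractf)
  have "(LINT x|unit_lborel. (norm ((\<Sum>h\<in>P. f (real h * x)) - of_nat (card P) * c 0))\<^sup>2)
      \<le> W * (\<Sum>i\<in>P \<times> Z. (norm (c (snd i)))\<^sup>2)"
    unfolding expand
  proof (rule mean_square_exp_sum_le)
    fix v assume "v \<in> (\<lambda>i. int (fst i) * snd i) ` (P \<times> Z)"
    then obtain h j where hj: "h \<in> P" "j \<in> Z" "v = int h * j" by auto
    then have "v \<noteq> 0" "nat \<bar>j\<bar> \<le> J" "h \<le> H" using P by (auto simp: Z_def)
    then have "nat \<bar>v\<bar> \<le> J * H"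
      using mult_mono[of "nat \<bar>j\<bar>" J h H] by (simp add: hj(3) nat_abs_mult_distrib mult.commute)
    then have "real (card {h \<in> P. h dvd nat \<bar>v\<bar>}) \<le> W"
      using \<open>v \<noteq> 0\<close> by (intro divisors) auto
    then show "real (card {i \<in> P \<times> Z. int (fst i) * snd i = v}) \<le> W"
      using card_factorizations_le[OF fin \<open>v \<noteq> 0\<close>, of Z] by linarith
  qed (use fin Z in simp)
  also have "(\<Sum>i\<in>P \<times> Z. (norm (c (snd i)))\<^sup>2) = real (card P) * (\<Sum>j\<in>Z. (norm (c j))\<^sup>2)"
    using sum.cartesian_product[of "\<lambda>h j. (norm (c j))\<^sup>2" Z P] by (simp add: case_prod_unfold)
  also have "\<dots> \<le> real (card P) * (LINT x|unit_lborel. (norm (f x))\<^sup>2)"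
    unfolding parseval by (intro mult_left_mono sum_mono2) (auto simp: Z_def)
  finally show ?thesis using W unfolding mean by (simp add: mult_left_mono)
qed

lemma dilates_exceed_half_mean:
  fixes \<phi> :: "real \<Rightarrow> real" and P :: "nat set" and W :: real
  defines "m \<equiv> (LINT x|unit_lborel. \<phi> x)"
  assumes \<phi>: "trig_poly J (\<lambda>x. complex_of_real (\<phi> x))" "\<And>x. 0 \<le> \<phi> x" "\<And>x. \<phi> x \<le> 1"
    and P: "P \<subseteq> {1..H}" "P \<noteq> {}" and W: "0 \<le> W"
    and divisors: "\<And>n. 0 < n \<Longrightarrow> n \<le> J * H \<Longrightarrow> real (card {h \<in> P. h dvd n}) \<le> W"
    and m: "0 < m"
  shows "holds_except unit_lborel (4 * W / (real (card P) * m)) (\<lambda>x. \<exists>h\<in>P. m / 2 < \<phi> (real h * x))"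
proof -
  define T where "T x = (\<Sum>h\<in>P. \<phi> (real h * x)) - real (card P) * m" for x
  define A where "A = real (card P) * m"
  have "finite P" using P finite_subset by blast
  then have A: "0 < A" using P m by (simp add: A_def card_gt_0_iff)
  have cont_\<phi>: "continuous_on B \<phi>" for B
    using continuous_on_Re[OF trig_poly_continuous_on[OF \<phi>(1)]] by simp
  have cont_T: "continuous_on B T" for B
    unfolding T_def by (intro continuous_intros continuous_on_compose2[OF cont_\<phi>[of UNIV]]) auto
  have norm_T: "norm ((\<Sum>h\<in>P. complex_of_real (\<phi> (real h * x)))
      - of_nat (card P) * (LINT x|unit_lborel. complex_of_real (\<phi> x))) = \<bar>T x\<bar>" for x
    unfolding integral_complex_of_real m_def[symmetric]
    by (simp add: T_def norm_of_real[symmetric, where 'a = complex] del: norm_of_real)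
  have "(LINT x|unit_lborel. (T x)\<^sup>2) \<le> W * (real (card P) * (LINT x|unit_lborel. (\<phi> x)\<^sup>2))"
    using mean_square_dilates_le[OF \<phi>(1) P(1) W divisors]
    by (simp only: norm_T norm_of_real power2_abs)
  also have "\<dots> \<le> W * A"
    unfolding A_def m_def
  proof (intro mult_left_mono integral_mono integrable_unit_lborel continuous_intros cont_\<phi> W)
    show "(\<phi> x)\<^sup>2 \<le> \<phi> x" for x using \<phi>(2,3) by (simp add: power2_eq_square mult_left_le)
  qed simp
  finally have "(LINT x|unit_lborel. (T x)\<^sup>2) / (A / 2)\<^sup>2 \<le> W * A / (A / 2)\<^sup>2"
    by (rule divide_right_mono) simp
  also have "\<dots> = 4 * W / A" using A by (simp add: power2_eq_square field_simps)
  finally have variance: "(LINT x|unit_lborel. (T x)\<^sup>2) / (A / 2)\<^sup>2 \<le> 4 * W / A" .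
  have "holds_except unit_lborel ((LINT x|unit_lborel. (T x)\<^sup>2) / (A / 2)\<^sup>2) (\<lambda>x. \<bar>T x\<bar> < A / 2)"
    using A by (intro unit_lborel.holds_except_second_moment borel_measurable_integrable
        integrable_unit_lborel continuous_intros cont_T) auto
  then show ?thesis
  proof (rule holds_except_mono)
    fix x assume "\<bar>T x\<bar> < A / 2"
    then have "real (card P) * m / 2 < (\<Sum>h\<in>P. \<phi> (real h * x))"
      unfolding T_def A_def by linarith
    then have "(\<Sum>h\<in>P. m / 2) < (\<Sum>h\<in>P. \<phi> (real h * x))" by simp
    then show "\<exists>h\<in>P. m / 2 < \<phi> (real h * x)" by (meson not_le sum_mono)
  qed (use variance in \<open>simp add: A_def\<close>)
qed

section \<open>The divisor bound\<close>

lemma card_divisors_le_prod_multiplicity: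
  fixes n :: nat
  assumes "n > 0"
  shows "card {d. d dvd n} \<le> (\<Prod>p\<in>prime_factors n. Suc (multiplicity p n))"
proof -
  have "card {d. d dvd n} \<le> card (PiE (prime_factors n) (\<lambda>p. {..multiplicity p n}))"
  proof (rule card_inj_on_le[where f = "\<lambda>d. restrict (\<lambda>p. multiplicity p d) (prime_factors n)"])
    show "inj_on (\<lambda>d. restrict (\<lambda>p. multiplicity p d) (prime_factors n)) {d. d dvd n}"
    proof (rule inj_onI)
      fix d d' assume dvd: "d \<in> {d. d dvd n}" "d' \<in> {d. d dvd n}"
        and eq: "restrict (\<lambda>p. multiplicity p d) (prime_factors n)
               = restrict (\<lambda>p. multiplicity p d') (prime_factors n)"
      show "d = d'"
      proof (rule multiplicity_eq_nat)
        fix p :: nat assume "prime p"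
        show "multiplicity p d = multiplicity p d'"
        proof (cases "p dvd n")
          case True
          then show ?thesis
            using \<open>prime p\<close> assms fun_cong[OF eq, of p] by (simp add: in_prime_factors_iff)
        next
          case False
          then have "\<not> p dvd d" "\<not> p dvd d'" using dvd dvd_trans by blast+
          then show ?thesis by (simp add: not_dvd_imp_multiplicity_0)
        qed
      qed (use dvd assms in \<open>auto intro: dvd_pos_nat\<close>)
    qed
    show "(\<lambda>d. restrict (\<lambda>p. multiplicity p d) (prime_factors n)) ` {d. d dvd n}
        \<subseteq> PiE (prime_factors n) (\<lambda>p. {..multiplicity p n})"
      using assms by (auto intro: dvd_imp_multiplicity_le)
  qed (simp add: finite_PiE)
  then show ?thesis by (simp add: card_PiE)
qed

lemma Suc_le_mult_prime_powr:
  fixes p k :: nat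
  assumes "2 \<le> p" "0 < \<epsilon>"
  shows "real (Suc k) \<le> (if real p < 2 powr (1 / \<epsilon>) then 1 + 1 / (\<epsilon> * ln 2) else 1) * (real p ^ k) powr \<epsilon>"
proof (cases "real p < 2 powr (1 / \<epsilon>)")
  case True
  define b where "b = \<epsilon> * ln 2"
  have "b > 0" using assms by (simp add: b_def)
  have "real (Suc k) \<le> (1 + 1 / b) * (1 + b * real k)"
    using \<open>b > 0\<close> by (simp add: field_simps)
  also have "\<dots> \<le> (1 + 1 / b) * exp (b * real k)"
    using \<open>b > 0\<close> by (intro mult_left_mono exp_ge_add_one_self) auto
  also have "exp (b * real k) = (2 ^ k) powr \<epsilon>"
    by (simp add: b_def powr_def ln_realpow mult_ac)
  also have "(1 + 1 / b) * (2 ^ k) powr \<epsilon> \<le> (1 + 1 / b) * (real p ^ k) powr \<epsilon>"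
    using assms \<open>b > 0\<close> by (intro mult_left_mono powr_mono2 power_mono) auto
  finally show ?thesis using True by (simp add: b_def)
next
  case False
  have "real (Suc k) \<le> 2 ^ k" using Suc_leI[OF less_exp, of k] of_nat_le_iff[of "Suc k" "2 ^ k"] by simp
  also have "\<dots> = ((2 powr (1 / \<epsilon>)) ^ k) powr \<epsilon>"
    using assms by (simp add: powr_powr powr_power powr_realpow[symmetric])
  also have "\<dots> \<le> (real p ^ k) powr \<epsilon>"
    using False assms by (intro powr_mono2 power_mono) auto
  finally show ?thesis using False by simp
qed

theorem divisor_bound:
  assumes "0 < \<epsilon>"
  shows "\<exists>C. \<forall>n>0. real (card {d. d dvd n}) \<le> C * real n powr \<epsilon>"
proof -
  define A where "A = 1 + 1 / (\<epsilon> * ln 2)"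
  define S where "S = {p::nat. real p < 2 powr (1 / \<epsilon>)}"
  have A: "1 \<le> A" using assms by (simp add: A_def)
  have "S \<subseteq> {..nat \<lceil>2 powr (1 / \<epsilon>)\<rceil>}" unfolding S_def by (auto simp: nat_le_iff) linarith
  then have S: "finite S" using finite_subset by blast
  have "real (card {d. d dvd n}) \<le> A ^ card S * real n powr \<epsilon>" if n: "n > 0" for n :: nat
  proof -
    have "real (card {d. d dvd n}) \<le> (\<Prod>p\<in>prime_factors n. real (Suc (multiplicity p n)))"
      using card_divisors_le_prod_multiplicity[OF n] by (simp only: of_nat_prod[symmetric] of_nat_le_iff)
    also have "\<dots> \<le> (\<Prod>p\<in>prime_factors n. (if p \<in> S then A else 1) * real (p ^ multiplicity p n) powr \<epsilon>)"
    proof (intro prod_mono conjI)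
      fix p assume "p \<in> prime_factors n"
      then have "2 \<le> p" by (auto simp: in_prime_factors_iff prime_ge_2_nat)
      from Suc_le_mult_prime_powr[OF this assms, of "multiplicity p n"]
      show "real (Suc (multiplicity p n)) \<le> (if p \<in> S then A else 1) * real (p ^ multiplicity p n) powr \<epsilon>"
        by (simp only: S_def A_def mem_Collect_eq of_nat_power)
    qed simp
    also have "\<dots> = A ^ card (prime_factors n \<inter> S) * real n powr \<epsilon>"
      using n by (simp add: prod.distrib prod.If_cases prod_powr_distrib[symmetric] prime_factorization_nat[symmetric]
          of_nat_prod[symmetric] del: of_nat_prod of_nat_power)
    also have "\<dots> \<le> A ^ card S * real n powr \<epsilon>"
      using A S by (intro mult_right_mono power_increasing card_mono) auto
    finally show ?thesis .
  qed
  then show ?thesis by blast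
qed

definition divisor_count_bounded :: "real \<Rightarrow> real \<Rightarrow> bool" where
  "divisor_count_bounded M W \<longleftrightarrow> (\<forall>n>0. real n \<le> M \<longrightarrow> real (card {d. d dvd n}) \<le> W)"

lemma divisor_count_bounded_antimono:
  "divisor_count_bounded M W \<Longrightarrow> M' \<le> M \<Longrightarrow> divisor_count_bounded M' W"
  unfolding divisor_count_bounded_def by (meson order.trans)

lemma eventually_divisor_count_bounded_powr:
  fixes s :: nat
  assumes "0 < \<delta>"
  shows "\<forall>\<^sub>F N in sequentially. divisor_count_bounded (real N ^ s) (real N powr \<delta>)"
proof -
  define \<epsilon> where "\<epsilon> = \<delta> / (2 * (real s + 1))"
  have \<epsilon>: "0 < \<epsilon>" "real s * \<epsilon> \<le> \<delta> / 2" using assms by (simp_all add: \<epsilon>_def field_simps)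
  obtain C where C: "\<And>n. n > 0 \<Longrightarrow> real (card {d. d dvd n}) \<le> C * real n powr \<epsilon>"
    using divisor_bound[OF \<epsilon>(1)] by blast
  have "\<forall>\<^sub>F N in sequentially. \<bar>C\<bar> * real N powr (\<delta> / 2) \<le> real N powr \<delta>"
    using assms by real_asymp
  then show ?thesis using eventually_ge_at_top[of 1]
  proof eventually_elim
    case (elim N)
    show ?case
      unfolding divisor_count_bounded_def
    proof (intro allI impI)
      fix n :: nat assume n: "0 < n" "real n \<le> real N ^ s"
      have "real (card {d. d dvd n}) \<le> \<bar>C\<bar> * real n powr \<epsilon>"
        using C[OF n(1)] abs_ge_self[of C] by (meson mult_right_mono order.trans powr_ge_zero)
      also have "\<dots> \<le> \<bar>C\<bar> * (real N ^ s) powr \<epsilon>"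
        using n \<epsilon> by (intro mult_left_mono powr_mono2) auto
      also have "\<dots> = \<bar>C\<bar> * real N powr (real s * \<epsilon>)"
        using elim(2) by (simp add: powr_realpow[symmetric] powr_powr)
      also have "\<dots> \<le> \<bar>C\<bar> * real N powr (\<delta> / 2)"
        using elim(2) \<epsilon> by (intro mult_left_mono powr_mono) auto
      also have "\<dots> \<le> real N powr \<delta>" by (rule elim(1))
      finally show "real (card {d. d dvd n}) \<le> real N powr \<delta>" .
    qed
  qed
qed

section \<open>Large values of exponential sums\<close>

lemma one_minus_power_bounds:
  fixes z :: real
  assumes "0 \<le> z" "z \<le> 1"
  shows "0 \<le> 1 - (1 - z) ^ d" "1 - (1 - z) ^ d \<le> 1" "1 - (1 - z) ^ d \<le> real d * z"
    "1 \<le> real d * z \<Longrightarrow> 1 / 2 \<le> 1 - (1 - z) ^ d"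
proof -
  show "0 \<le> 1 - (1 - z) ^ d" using assms by (simp add: power_le_one)
  show "1 - (1 - z) ^ d \<le> 1" using assms by simp
  show "1 - (1 - z) ^ d \<le> real d * z"
    using Bernoulli_inequality[of "- z" d] assms by simp
  assume dz: "1 \<le> real d * z"
  have "(1 - z) ^ d \<le> exp (- z) ^ d"
    using exp_ge_add_one_self[of "- z"] assms by (intro power_mono) auto
  also have "\<dots> = exp (- (real d * z))" by (simp add: exp_of_nat_mult[symmetric])
  also have "\<dots> \<le> exp (- 1)" using dz by simp
  also have "\<dots> \<le> 1 / 2"
    using exp_ge_add_one_self[of 1] by (simp add: exp_minus field_simps)
  finally show "1 / 2 \<le> 1 - (1 - z) ^ d" by simp
qed

lemma exists_soft_level_indicator:
  fixes f :: "real \<Rightarrow> complex" and B y :: real and K r :: nat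
  assumes f: "trig_poly K f" and bound: "\<And>x. norm (f x) \<le> B" and y: "0 < y" "y \<le> B"
  obtains \<phi> :: "real \<Rightarrow> real" and J :: nat
  where "trig_poly J (\<lambda>x. complex_of_real (\<phi> x))" "real J \<le> 4 * real r * real K * (B / y) ^ (2 * r)"
    and "\<And>x. 0 \<le> \<phi> x" "\<And>x. \<phi> x \<le> 1" "\<And>x. \<phi> x \<le> 2 * (norm (f x) / y) ^ (2 * r)"
    and "\<And>x. y \<le> norm (f x) \<Longrightarrow> 1 / 2 \<le> \<phi> x"
proof -
  define d where "d = nat \<lceil>(B / y) ^ (2 * r)\<rceil>"
  have "1 \<le> (B / y) ^ (2 * r)" using y by (intro one_le_power) auto
  then have d: "(B / y) ^ (2 * r) \<le> real d" "real d \<le> 2 * (B / y) ^ (2 * r)"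
    unfolding d_def by linarith+
  define z where "z x = (norm (f x) / B) ^ (2 * r)" for x
  have z: "0 \<le> z x" "z x \<le> 1" for x
    using bound[of x] y by (auto simp: z_def power_le_one)
  define \<phi> where "\<phi> x = 1 - (1 - z x) ^ d" for x
  show thesis
  proof (rule that[of "d * (r * (K + K))" \<phi>])
    have "complex_of_real (\<phi> x) = 1 - (1 - (inverse (of_real B ^ 2) * (f x * cnj (f x))) ^ r) ^ d" for x
      by (simp add: \<phi>_def z_def complex_norm_square[symmetric] power_mult_distrib power_inverse
          divide_inverse power_mult[symmetric] mult_ac)
    then show "trig_poly (d * (r * (K + K))) (\<lambda>x. complex_of_real (\<phi> x))"
      by (simp only:) (intro trig_poly_diff trig_poly_power trig_poly_const trig_poly_const_mult
          trig_poly_mult trig_poly_cnj f)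
    show "real (d * (r * (K + K))) \<le> 4 * real r * real K * (B / y) ^ (2 * r)"
      using mult_right_mono[OF d(2), of "2 * real r * real K"] by (simp add: mult_ac)
    show "0 \<le> \<phi> x" "\<phi> x \<le> 1" for x
      unfolding \<phi>_def by (intro one_minus_power_bounds z)+
    show "\<phi> x \<le> 2 * (norm (f x) / y) ^ (2 * r)" for x
    proof -
      have "\<phi> x \<le> real d * z x" unfolding \<phi>_def by (intro one_minus_power_bounds z)
      also have "\<dots> \<le> 2 * (B / y) ^ (2 * r) * z x" using d(2) z(1) by (rule mult_right_mono)
      also have "\<dots> = 2 * (norm (f x) / y) ^ (2 * r)" using y by (simp add: z_def power_divide)
      finally show ?thesis .
    qed
    show "1 / 2 \<le> \<phi> x" if "y \<le> norm (f x)" for x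
    proof -
      have "1 = (B / y) ^ (2 * r) * (y / B) ^ (2 * r)"
        using y by (simp add: power_mult_distrib[symmetric])
      also have "\<dots> \<le> real d * z x"
        unfolding z_def using d(1) y that by (intro mult_mono power_mono divide_right_mono) auto
      finally show ?thesis unfolding \<phi>_def by (intro one_minus_power_bounds(4) z)
    qed
  qed
qed

definition level_measure :: "(real \<Rightarrow> complex) \<Rightarrow> real \<Rightarrow> real" where
  "level_measure f y = measure unit_lborel {x \<in> {0..1}. y \<le> norm (f x)}"

lemma level_measure_le_1: "level_measure f y \<le> 1"
  using unit_lborel.bounded_measure[of "{x \<in> {0..1}. y \<le> norm (f x)}"] by (simp add: level_measure_def)

lemma level_measure_le_mean:
  assumes "integrable unit_lborel \<phi>" "\<And>x. 0 \<le> \<phi> x" "\<And>x. y \<le> norm (f x) \<Longrightarrow> c \<le> \<phi> x" "0 < c"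
  shows "c * level_measure f y \<le> (LINT x|unit_lborel. \<phi> x)"
proof -
  have [measurable]: "\<phi> \<in> borel_measurable unit_lborel" using assms(1) by simp
  have "{x \<in> space unit_lborel. c \<le> \<phi> x} \<in> sets unit_lborel" by measurable
  then have "level_measure f y \<le> measure unit_lborel {x \<in> space unit_lborel. c \<le> \<phi> x}"
    unfolding level_measure_def using assms(3) by (intro unit_lborel.finite_measure_mono) auto
  also have "\<dots> \<le> (LINT x|unit_lborel. \<phi> x) / c"
    by (rule integral_Markov_inequality_measure[where A = "{}"]) (use assms in auto)
  finally show ?thesis using assms(4) by (simp add: field_simps)
qed

lemma exists_large_level:
  fixes f :: "real \<Rightarrow> complex" and N :: nat
  assumes int: "integrable unit_lborel (\<lambda>x. norm (f x))" and bound: "\<And>x. norm (f x) \<le> real N"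
    and L1: "2 \<le> (LINT x|unit_lborel. norm (f x))" (is "2 \<le> ?I")
  obtains y where "1 \<le> y" "y \<le> real N" "?I / (2 * (log 2 (real N) + 1)) \<le> y * level_measure f y"
    and "1 / (real N)\<^sup>2 \<le> level_measure f y"
proof -
  have "N > 0" using assms by (cases "N = 0") auto
  define n where "n = Suc (floor_log N)"
  have "2 ^ floor_log N \<le> N" "N < 2 ^ n" "n \<le> 2 ^ floor_log N"
    using floor_log_exp2_le[OF \<open>N > 0\<close>] floor_log_exp2_gt[of N] Suc_leI[OF less_exp]
    by (simp_all add: n_def)
  then have "real (2 ^ floor_log N) \<le> real N" "real N < real (2 ^ n)" "real n \<le> real N"
    by (simp_all only: of_nat_le_iff of_nat_less_iff)
  then have n: "2 ^ floor_log N \<le> real N" "real N < 2 ^ n" "real n \<le> real N" by simp_all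
  have n_log: "real n \<le> log 2 (real N) + 1"
    using n(1) \<open>N > 0\<close> by (simp add: n_def le_log_iff powr_realpow)
  have "norm (f x) < 2 ^ n" for x using bound[of x] n(2) by linarith
  then obtain k where k: "k < n" "?I - 1 \<le> real n * (2 ^ k * level_measure f (2 ^ k))"
    using unit_lborel.exists_dyadic_level[OF int, of n] by (auto simp: n_def level_measure_def)
  define y where "y = (2::real) ^ k"
  have "1 \<le> y" "y \<le> 2 ^ floor_log N"
    unfolding y_def using k(1) by (auto simp: n_def intro: power_increasing)
  with n(1) have y: "1 \<le> y" "y \<le> real N" by linarith+
  have mass: "?I / 2 \<le> real n * (y * level_measure f y)"
    using k(2) L1 unfolding y_def by linarith
  have "?I / (2 * (log 2 (real N) + 1)) \<le> ?I / (2 * real n)"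
    using n_log L1 by (intro divide_left_mono) (auto simp: n_def)
  also have "\<dots> \<le> y * level_measure f y" using mass by (simp add: n_def field_simps)
  finally have level: "?I / (2 * (log 2 (real N) + 1)) \<le> y * level_measure f y" .
  have "1 \<le> real n * (y * level_measure f y)" using mass L1 by linarith
  also have "\<dots> \<le> real N * (real N * level_measure f y)"
    using n(3) y by (intro mult_mono mult_right_mono) (auto simp: level_measure_def)
  finally have "1 / (real N)\<^sup>2 \<le> level_measure f y"
    using \<open>N > 0\<close> by (simp add: field_simps power2_eq_square)
  then show thesis using that y level by blast
qed

text \<open>
  Since \<open>\<phi>\<close> does not vanish below the level \<open>y\<close>, a large value of \<open>\<phi>\<close> does not force \<open>|f| \<ge> y\<close>; this
  costs the factor \<open>root (2 * r) (\<mu> / 8)\<close>, which tends to \<open>1\<close> as \<open>r\<close> grows.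
\<close>

lemma dilates_reach_level:
  fixes f :: "real \<Rightarrow> complex" and B y W :: real
  defines "\<mu> \<equiv> level_measure f y"
  assumes f: "trig_poly K f" and bound: "\<And>x. norm (f x) \<le> B" and y: "0 < y" "y \<le> B"
    and \<mu>: "0 < \<mu>" and r: "0 < r" and H: "0 < H" and W: "0 \<le> W"
    and divisors: "divisor_count_bounded (4 * real r * real K * (B / y) ^ (2 * r) * real H) W"
  shows "holds_except unit_lborel (8 * W / (real H * \<mu>))
      (\<lambda>x. \<exists>h\<in>{1..H}. y * root (2 * r) (\<mu> / 8) \<le> norm (f (real h * x)))"
proof -
  obtain \<phi> J where \<phi>: "trig_poly J (\<lambda>x. complex_of_real (\<phi> x))" "\<And>x. 0 \<le> \<phi> x" "\<And>x. \<phi> x \<le> 1"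
    and J: "real J \<le> 4 * real r * real K * (B / y) ^ (2 * r)"
    and \<phi>_le: "\<And>x. \<phi> x \<le> 2 * (norm (f x) / y) ^ (2 * r)"
    and \<phi>_ge: "\<And>x. y \<le> norm (f x) \<Longrightarrow> 1 / 2 \<le> \<phi> x"
    using exists_soft_level_indicator[OF f bound y, of r] by metis
  define m where "m = (LINT x|unit_lborel. \<phi> x)"
  have "continuous_on {0..1} \<phi>"
    using continuous_on_Re[OF trig_poly_continuous_on[OF \<phi>(1)]] by simp
  then have m: "\<mu> / 2 \<le> m"
    using level_measure_le_mean[OF integrable_unit_lborel \<phi>(2) \<phi>_ge] by (simp add: \<mu>_def m_def)
  have "holds_except unit_lborel (4 * W / (real (card {1..H}) * m)) (\<lambda>x. \<exists>h\<in>{1..H}. m / 2 < \<phi> (real h * x))"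
    unfolding m_def
  proof (rule dilates_exceed_half_mean[OF \<phi> order.refl])
    fix n :: nat assume n: "0 < n" "n \<le> J * H"
    have "real n \<le> real J * real H" using n(2) by (metis of_nat_le_iff of_nat_mult)
    also have "\<dots> \<le> 4 * real r * real K * (B / y) ^ (2 * r) * real H"
      using J by (rule mult_right_mono) simp
    finally have "real (card {d. d dvd n}) \<le> W"
      using n(1) divisors by (simp add: divisor_count_bounded_def)
    moreover have "card {h \<in> {1..H}. h dvd n} \<le> card {d. d dvd n}"
      using n(1) by (intro card_mono) auto
    ultimately show "real (card {h \<in> {1..H}. h dvd n}) \<le> W" by linarith
  qed (use H W m \<mu> in \<open>auto simp: m_def\<close>)
  then show ?thesis
  proof (rule holds_except_mono)
    have "4 * W / (real H * m) \<le> 4 * W / (real H * (\<mu> / 2))"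
      using m \<mu> H W by (intro divide_left_mono mult_left_mono mult_pos_pos) auto
    then show "4 * W / (real (card {1..H}) * m) \<le> 8 * W / (real H * \<mu>)" by simp
    fix x assume "\<exists>h\<in>{1..H}. m / 2 < \<phi> (real h * x)"
    then obtain h where h: "h \<in> {1..H}" "m / 2 < \<phi> (real h * x)" by blast
    then have "\<mu> / 8 \<le> (norm (f (real h * x)) / y) ^ (2 * r)"
      using m \<phi>_le[of "real h * x"] by linarith
    then have "root (2 * r) (\<mu> / 8) \<le> norm (f (real h * x)) / y"
      using r y real_root_le_mono[of "2 * r" "\<mu> / 8" "(norm (f (real h * x)) / y) ^ (2 * r)"]
      by (simp add: real_root_power_cancel)
    then show "\<exists>h\<in>{1..H}. y * root (2 * r) (\<mu> / 8) \<le> norm (f (real h * x))"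
      using h(1) y by (auto simp: field_simps)
  qed
qed

section \<open>Discrepancy and the mean of the exponential sum\<close>

definition weyl_L1_norm :: "(nat \<Rightarrow> int) \<Rightarrow> nat \<Rightarrow> real" where
  "weyl_L1_norm a N = (LINT x|unit_lborel. norm (weyl_sum a N x))"

lemma weyl_L1_norm_eq_set_lebesgue_integral:
  "weyl_L1_norm a N = (LINT \<alpha>:{0..1}|lborel.
     norm (\<Sum>n=1..N. exp (2 * pi * \<i> * complex_of_real (real_of_int (a n) * \<alpha>))))"
  unfolding weyl_L1_norm_def lebesgue_integral_unit_lborel weyl_sum_def circle_char_def cis_conv_exp
  by (simp add: mult_ac)

lemma trig_poly_weyl_sum:
  assumes "\<And>n. n \<in> {1..N} \<Longrightarrow> \<bar>a n\<bar> \<le> int K"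
  shows "trig_poly K (weyl_sum a N)"
  unfolding weyl_sum_def[abs_def] by (intro trig_poly_sum trig_poly_circle_char assms)

lemma integrable_norm_weyl_sum: "integrable unit_lborel (\<lambda>x. norm (weyl_sum a N x))"
  unfolding weyl_sum_def by (intro integrable_unit_lborel continuous_intros)

lemma discrepancy_ge_weyl_level:
  fixes a :: "nat \<Rightarrow> int" and N K r :: nat and y X W :: real
  defines "\<mu> \<equiv> level_measure (weyl_sum a N) y"
  assumes a: "\<And>n. n \<in> {1..N} \<Longrightarrow> \<bar>a n\<bar> \<le> int K" and y: "0 < y" "y \<le> real N" and \<mu>: "0 < \<mu>"
    and r: "0 < r" and X: "1 \<le> X" and W: "0 \<le> W"
    and divisors: "divisor_count_bounded (8 * real r * real K * (real N / y) ^ (2 * r) * (X / \<mu>)) W"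
  shows "holds_except unit_lborel (8 * W / X)
    (\<lambda>x. y * \<mu> * root (2 * r) (\<mu> / 8) / (4 * pi * X)
       \<le> real N * discrepancy (\<lambda>n. frac (of_int (a n) * x)) N)"
proof -
  have poly: "trig_poly K (weyl_sum a N)" using a by (rule trig_poly_weyl_sum)
  have "1 \<le> X / \<mu>" using X \<mu> level_measure_le_1[of "weyl_sum a N" y] by (simp add: \<mu>_def)
  moreover define H where "H = nat \<lceil>X / \<mu>\<rceil>"
  ultimately have H: "X / \<mu> \<le> real H" "real H \<le> 2 * (X / \<mu>)" "0 < H" by linarith+
  have "4 * real r * real K * (real N / y) ^ (2 * r) * real H
      \<le> 4 * real r * real K * (real N / y) ^ (2 * r) * (2 * (X / \<mu>))"
    using H(2) y by (intro mult_left_mono) auto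
  then have "divisor_count_bounded (4 * real r * real K * (real N / y) ^ (2 * r) * real H) W"
    by (intro divisor_count_bounded_antimono[OF divisors]) simp
  with \<mu> have "holds_except unit_lborel (8 * W / (real H * \<mu>))
      (\<lambda>x. \<exists>h\<in>{1..H}. y * root (2 * r) (\<mu> / 8) \<le> norm (weyl_sum a N (real h * x)))"
    unfolding \<mu>_def
    by (rule dilates_reach_level[OF poly norm_weyl_sum_le y _ r H(3) W])
  then show ?thesis
  proof (rule holds_except_mono)
    show "8 * W / (real H * \<mu>) \<le> 8 * W / X"
      using H \<mu> X W by (intro divide_left_mono) (auto simp: field_simps)
    fix x assume "\<exists>h\<in>{1..H}. y * root (2 * r) (\<mu> / 8) \<le> norm (weyl_sum a N (real h * x))"
    then obtain h where h: "h \<in> {1..H}" "y * root (2 * r) (\<mu> / 8) \<le> norm (weyl_sum a N (real h * x))"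
      by blast
    define D where "D = real N * discrepancy (\<lambda>n. frac (of_int (a n) * x)) N"
    have "0 \<le> D" unfolding D_def by (rule of_nat_mult_discrepancy_nonneg)
    note h(2)
    also have "norm (weyl_sum a N (real h * x)) \<le> 2 * pi * real h * D"
      using h(1) unfolding D_def by (intro norm_weyl_sum_dilate_le_discrepancy) auto
    also have "\<dots> \<le> 2 * pi * (2 * (X / \<mu>)) * D"
      using h(1) H \<open>0 \<le> D\<close> by (intro mult_left_mono mult_right_mono) auto
    finally show "y * \<mu> * root (2 * r) (\<mu> / 8) / (4 * pi * X) \<le> D"
      using X \<mu> by (simp add: field_simps)
  qed
qed

lemma discrepancy_ge_weyl_L1_norm:
  fixes a :: "nat \<Rightarrow> int" and N K r :: nat and X W :: real
  assumes a: "\<And>n. n \<in> {1..N} \<Longrightarrow> \<bar>a n\<bar> \<le> int K" and L1: "2 \<le> weyl_L1_norm a N"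
    and r: "0 < r" and X: "1 \<le> X" and W: "0 \<le> W"
    and divisors: "divisor_count_bounded (8 * real r * real K * X * real N ^ (2 * r + 2)) W"
  shows "holds_except unit_lborel (8 * W / X)
    (\<lambda>x. weyl_L1_norm a N / (8 * pi * (log 2 (real N) + 1) * X) * root (2 * r) (1 / (8 * (real N)\<^sup>2))
       \<le> real N * discrepancy (\<lambda>n. frac (of_int (a n) * x)) N)"
proof -
  define Lg where "Lg = log 2 (real N) + 1"
  obtain y where y: "1 \<le> y" "y \<le> real N"
    and large: "weyl_L1_norm a N / (2 * Lg) \<le> y * level_measure (weyl_sum a N) y" (is "_ \<le> y * ?\<mu>")
    and \<mu>_ge: "1 / (real N)\<^sup>2 \<le> level_measure (weyl_sum a N) y"
    using exists_large_level[OF integrable_norm_weyl_sum norm_weyl_sum_le] L1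
    unfolding weyl_L1_norm_def Lg_def by blast
  have N: "0 < real N" using y by linarith
  then have \<mu>: "0 < ?\<mu>" by (intro less_le_trans[OF _ \<mu>_ge]) simp
  have "X / ?\<mu> \<le> X * (real N)\<^sup>2"
    using mult_left_mono[OF \<mu>_ge, of "X * (real N)\<^sup>2"] X \<mu> N by (simp add: field_simps)
  moreover have "(real N / y) ^ (2 * r) \<le> real N ^ (2 * r)"
    using y by (intro power_mono) (auto simp: field_simps)
  ultimately have "8 * real r * real K * (real N / y) ^ (2 * r) * (X / ?\<mu>)
      \<le> 8 * real r * real K * real N ^ (2 * r) * (X * (real N)\<^sup>2)"
    using X \<mu> by (intro mult_mono mult_left_mono) auto
  also have "\<dots> = 8 * real r * real K * X * real N ^ (2 * r + 2)"
    by (simp only: power_add mult_ac)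
  finally have "divisor_count_bounded (8 * real r * real K * (real N / y) ^ (2 * r) * (X / ?\<mu>)) W"
    by (rule divisor_count_bounded_antimono[OF divisors])
  then have "holds_except unit_lborel (8 * W / X) (\<lambda>x. y * ?\<mu> * root (2 * r) (?\<mu> / 8) / (4 * pi * X)
       \<le> real N * discrepancy (\<lambda>n. frac (of_int (a n) * x)) N)"
    using y(1) by (intro discrepancy_ge_weyl_level[OF a _ y(2) \<mu> r X W]) auto
  then show ?thesis
    unfolding Lg_def[symmetric]
  proof (rule holds_except_mono)
    have "weyl_L1_norm a N / (2 * Lg) * root (2 * r) (1 / (8 * (real N)\<^sup>2)) \<le> y * ?\<mu> * root (2 * r) (?\<mu> / 8)"
      using large \<mu>_ge \<mu> y r N by (intro mult_mono) auto
    then have "weyl_L1_norm a N / (2 * Lg) * root (2 * r) (1 / (8 * (real N)\<^sup>2)) / (4 * pi * X)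
        \<le> y * ?\<mu> * root (2 * r) (?\<mu> / 8) / (4 * pi * X)"
      using X by (intro divide_right_mono) auto
    then show "weyl_L1_norm a N / (8 * pi * Lg * X) * root (2 * r) (1 / (8 * (real N)\<^sup>2)) \<le> D"
      if "y * ?\<mu> * root (2 * r) (?\<mu> / 8) / (4 * pi * X) \<le> D" for D
      using that by (simp add: mult_ac)
  qed simp
qed

lemma powr_minus_le_root:
  fixes x \<delta> :: real
  assumes x: "2 \<le> x" and r: "0 < r" "5 \<le> 2 * real r * \<delta>"
  shows "x powr - \<delta> \<le> root (2 * r) (1 / (8 * x\<^sup>2))"
proof -
  have "(x powr - \<delta>) ^ (2 * r) = x powr - (2 * real r * \<delta>)"
    using x r by (simp add: powr_power mult_ac)
  also have "\<dots> \<le> x powr - 5"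
    using x r by (intro powr_mono) auto
  also have "\<dots> = 1 / x ^ 5"
    using x by (simp add: powr_minus divide_inverse)
  also have "\<dots> \<le> 1 / (8 * x\<^sup>2)"
  proof (rule divide_left_mono)
    have "2 ^ 3 * x\<^sup>2 \<le> x ^ 3 * x\<^sup>2" using x by (intro mult_right_mono power_mono) auto
    then show "8 * x\<^sup>2 \<le> x ^ 5" by (simp add: power_add[symmetric])
  qed (use x in auto)
  finally have "root (2 * r) ((x powr - \<delta>) ^ (2 * r)) \<le> root (2 * r) (1 / (8 * x\<^sup>2))"
    using r by (intro real_root_le_mono) auto
  then show ?thesis using r by (simp add: real_root_power_cancel)
qed

lemma powr_less_divide_mult_root:
  fixes x \<delta> Q c :: real
  assumes x: "2 \<le> x" and r: "0 < r" "5 \<le> 2 * real r * \<delta>"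
    and Q: "0 < Q" "Q < x powr \<delta>" and c: "0 < c"
  shows "c * x powr (- 4 * \<delta>) < c / (Q * x powr (2 * \<delta>)) * root (2 * r) (1 / (8 * x\<^sup>2))"
proof -
  have "c * x powr (- 4 * \<delta>) = c / (x powr \<delta> * x powr (2 * \<delta>)) * x powr - \<delta>"
    using x by (simp add: powr_add[symmetric] powr_minus_divide)
  also have "\<dots> < c / (Q * x powr (2 * \<delta>)) * x powr - \<delta>"
    using Q x c by (intro mult_strict_right_mono divide_strict_left_mono) auto
  also have "\<dots> \<le> c / (Q * x powr (2 * \<delta>)) * root (2 * r) (1 / (8 * x\<^sup>2))"
    using powr_minus_le_root[OF x r] Q c by (intro mult_left_mono) auto
  finally show ?thesis .
qed

lemma eventually_abs_le_power_Suc: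
  fixes a :: "nat \<Rightarrow> int"
  assumes "\<forall>\<^sub>F n in sequentially. \<bar>real_of_int (a n)\<bar> \<le> real n ^ t"
  shows "\<forall>\<^sub>F N in sequentially. \<forall>n\<in>{1..N}. \<bar>a n\<bar> \<le> int (N ^ Suc t)"
proof -
  obtain n0 where n0: "\<And>n. n \<ge> n0 \<Longrightarrow> \<bar>real_of_int (a n)\<bar> \<le> real n ^ t"
    using assms by (auto simp: eventually_sequentially)
  show ?thesis
    using eventually_ge_at_top[of "nat (\<Sum>n<n0. \<bar>a n\<bar>)"] eventually_ge_at_top[of 1]
  proof (eventually_elim, intro ballI)
    fix N n :: nat assume N: "nat (\<Sum>n<n0. \<bar>a n\<bar>) \<le> N" "1 \<le> N" and n: "n \<in> {1..N}"
    show "\<bar>a n\<bar> \<le> int (N ^ Suc t)"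
    proof (cases "n < n0")
      case True
      then have "\<bar>a n\<bar> \<le> (\<Sum>n<n0. \<bar>a n\<bar>)" by (intro member_le_sum) auto
      also have "\<dots> \<le> int (N ^ 1)" using N by simp
      also have "\<dots> \<le> int (N ^ Suc t)" using N by (intro of_nat_mono power_increasing) auto
      finally show ?thesis .
    next
      case False
      then have "real_of_int \<bar>a n\<bar> \<le> real_of_int (int (n ^ t))" using n0[of n] by simp
      then have "\<bar>a n\<bar> \<le> int (n ^ t)" by (simp only: of_int_le_iff)
      also have "\<dots> \<le> int (N ^ t)" using n by (intro of_nat_mono power_mono) auto
      also have "\<dots> \<le> int (N ^ Suc t)" using N by (intro of_nat_mono power_increasing) auto
      finally show ?thesis .
    qed
  qed
qed

lemma discrepancy_gt_weyl_L1_norm: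
  fixes a :: "nat \<Rightarrow> int" and N r t :: nat
  assumes a: "\<And>n. n \<in> {1..N} \<Longrightarrow> \<bar>a n\<bar> \<le> int (N ^ Suc t)" and L1: "2 \<le> weyl_L1_norm a N"
    and \<delta>: "0 < \<delta>" "\<delta> \<le> 1 / 2" and r: "0 < r" "5 \<le> 2 * real r * \<delta>"
    and N: "2 \<le> N" "8 * r \<le> N" "8 * pi * (log 2 (real N) + 1) < real N powr \<delta>"
    and divisors: "divisor_count_bounded (real N ^ (2 * r + t + 5)) (real N powr \<delta>)"
  shows "holds_except unit_lborel (8 * real N powr - \<delta>)
    (\<lambda>x. weyl_L1_norm a N * real N powr (- 4 * \<delta>) < real N * discrepancy (\<lambda>n. frac (of_int (a n) * x)) N)"
proof -
  define X Q where "X = real N powr (2 * \<delta>)" and "Q = 8 * pi * (log 2 (real N) + 1)"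
  have X: "1 \<le> X" "X \<le> real N"
    using N(1) \<delta> powr_mono[of "2 * \<delta>" 1 "real N"] by (simp_all add: X_def ge_one_powr_ge_zero)
  have Q: "0 < Q" "Q < real N powr \<delta>"
    using N by (auto simp: Q_def intro!: mult_pos_pos add_nonneg_pos)
  have "8 * real r * real (N ^ Suc t) * X * real N ^ (2 * r + 2)
      \<le> real N * real (N ^ Suc t) * real N * real N ^ (2 * r + 2)"
    using N(2) X by (intro mult_mono) auto
  also have "\<dots> = real N ^ (2 * r + t + 5)"
    by (simp add: power_add eval_nat_numeral)
  finally have "divisor_count_bounded
      (8 * real r * real (N ^ Suc t) * X * real N ^ (2 * r + 2)) (real N powr \<delta>)"
    by (rule divisor_count_bounded_antimono[OF divisors])
  with a have "holds_except unit_lborel (8 * real N powr \<delta> / X)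
     (\<lambda>x. weyl_L1_norm a N / (Q * X) * root (2 * r) (1 / (8 * (real N)\<^sup>2))
       \<le> real N * discrepancy (\<lambda>n. frac (of_int (a n) * x)) N)"
    unfolding Q_def by (rule discrepancy_ge_weyl_L1_norm[OF _ L1 r(1) X(1) powr_ge_zero])
  then show ?thesis
  proof (rule holds_except_mono)
    show "8 * real N powr \<delta> / X \<le> 8 * real N powr - \<delta>"
      using powr_diff[of "real N" \<delta> "2 * \<delta>"] by (simp add: X_def)
    have "weyl_L1_norm a N * real N powr (- 4 * \<delta>)
        < weyl_L1_norm a N / (Q * X) * root (2 * r) (1 / (8 * (real N)\<^sup>2))"
      unfolding X_def by (rule powr_less_divide_mult_root[OF _ r Q]) (use N(1) L1 in auto)
    then show "weyl_L1_norm a N * real N powr (- 4 * \<delta>) < D"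
      if "weyl_L1_norm a N / (Q * X) * root (2 * r) (1 / (8 * (real N)\<^sup>2)) \<le> D" for D
      using that by linarith
  qed
qed

lemma eventually_discrepancy_gt_weyl_L1_norm:
  fixes a :: "nat \<Rightarrow> int"
  assumes growth: "\<forall>\<^sub>F n in sequentially. \<bar>real_of_int (a n)\<bar> \<le> real n ^ t"
    and \<delta>: "0 < \<delta>" "\<delta> \<le> 1 / 2"
  shows "\<forall>\<^sub>F N in sequentially. 2 \<le> weyl_L1_norm a N \<longrightarrow>
    holds_except unit_lborel (8 * real N powr - \<delta>)
      (\<lambda>x. weyl_L1_norm a N * real N powr (- 4 * \<delta>) < real N * discrepancy (\<lambda>n. frac (of_int (a n) * x)) N)"
proof -
  obtain r :: nat where "5 / (2 * \<delta>) < real r" using reals_Archimedean2 by blast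
  then have r: "5 \<le> 2 * real r * \<delta>" using \<delta> by (simp add: field_simps)
  then have "0 < r" by (cases r) auto
  have "\<forall>\<^sub>F N in sequentially. 8 * pi * (log 2 (real N) + 1) < real N powr \<delta>"
    unfolding log_def using \<delta>(1) by real_asymp
  then show ?thesis
    using eventually_abs_le_power_Suc[OF growth]
      eventually_divisor_count_bounded_powr[OF \<delta>(1), of "2 * r + t + 5"]
      eventually_ge_at_top[of "8 * r"] eventually_ge_at_top[of 2]
  proof eventually_elim
    case (elim N)
    show ?case
      using elim(2) by (intro impI discrepancy_gt_weyl_L1_norm[OF _ _ \<delta> \<open>0 < r\<close> r elim(5,4,1,3)]) auto
  qed
qed

lemma AE_eventually_discrepancy_gt_powr:
  fixes a :: "nat \<Rightarrow> int" and N :: "nat \<Rightarrow> nat"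
  assumes growth: "\<forall>\<^sub>F n in sequentially. \<bar>real_of_int (a n)\<bar> \<le> real n ^ t"
    and N: "filterlim N sequentially sequentially"
    and sparse: "\<And>\<delta>. 0 < \<delta> \<Longrightarrow> summable (\<lambda>L. real (N L) powr - \<delta>)"
    and L1: "\<And>\<epsilon>. 0 < \<epsilon> \<Longrightarrow> \<forall>\<^sub>F L in sequentially. real (N L) powr (\<tau> - \<epsilon>) < weyl_L1_norm a (N L)"
    and \<tau>: "0 < \<tau>" and \<epsilon>: "0 < \<epsilon>"
  shows "AE x in unit_lborel. \<forall>\<^sub>F L in sequentially.
     real (N L) powr (\<tau> - \<epsilon>) < real (N L) * discrepancy (\<lambda>n. frac (of_int (a n) * x)) (N L)"
proof (rule unit_lborel.AE_eventually_of_holds_except)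
  define \<delta> where "\<delta> = Min {\<epsilon> / 5, \<tau> / 2, 1 / 2}"
  have \<delta>: "0 < \<delta>" "5 * \<delta> \<le> \<epsilon>" "\<delta> < \<tau>" "\<delta> \<le> 1 / 2" using \<epsilon> \<tau> by (auto simp: \<delta>_def)
  show "summable (\<lambda>L. 8 * real (N L) powr - \<delta>)"
    by (intro summable_mult sparse \<delta>)
  have "\<forall>\<^sub>F n in sequentially. 2 \<le> real n powr (\<tau> - \<delta>)"
    using \<delta>(3) by real_asymp
  from eventually_compose_filterlim[OF this N] L1[OF \<delta>(1)]
    eventually_compose_filterlim[OF eventually_discrepancy_gt_weyl_L1_norm[OF growth \<delta>(1,4)] N]
    eventually_compose_filterlim[OF eventually_ge_at_top[of 1] N]
  show "\<forall>\<^sub>F L in sequentially. holds_except unit_lborel (8 * real (N L) powr - \<delta>)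
    (\<lambda>x. real (N L) powr (\<tau> - \<epsilon>) < real (N L) * discrepancy (\<lambda>n. frac (of_int (a n) * x)) (N L))"
  proof eventually_elim
    case (elim L)
    have "real (N L) powr (\<tau> - \<epsilon>) \<le> real (N L) powr (\<tau> - \<delta>) * real (N L) powr (- 4 * \<delta>)"
      using elim(4) \<delta> unfolding powr_add[symmetric] by (intro powr_mono) auto
    also have "\<dots> \<le> weyl_L1_norm a (N L) * real (N L) powr (- 4 * \<delta>)"
      using elim(2) by (intro mult_right_mono) auto
    finally have target: "real (N L) powr (\<tau> - \<epsilon>) \<le> weyl_L1_norm a (N L) * real (N L) powr (- 4 * \<delta>)" .
    have "2 \<le> weyl_L1_norm a (N L)" using elim(1,2) by linarith
    with elim(3) have "holds_except unit_lborel (8 * real (N L) powr - \<delta>)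
      (\<lambda>x. weyl_L1_norm a (N L) * real (N L) powr (- 4 * \<delta>)
         < real (N L) * discrepancy (\<lambda>n. frac (of_int (a n) * x)) (N L))"
      by (rule mp)
    then show ?case
      by (rule holds_except_mono) (use target in \<open>auto intro: le_less_trans\<close>)
  qed
qed

theorem AE_eventually_discrepancy_gt:
  fixes a :: "nat \<Rightarrow> int" and N :: "nat \<Rightarrow> nat"
  assumes growth: "\<forall>\<^sub>F n in sequentially. \<bar>real_of_int (a n)\<bar> \<le> real n ^ t"
    and N: "filterlim N sequentially sequentially"
    and sparse: "\<And>\<delta>. 0 < \<delta> \<Longrightarrow> summable (\<lambda>L. real (N L) powr - \<delta>)"
    and L1: "\<And>\<epsilon>. 0 < \<epsilon> \<Longrightarrow> \<forall>\<^sub>F L in sequentially. real (N L) powr (\<tau> - \<epsilon>) < weyl_L1_norm a (N L)"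
    and \<tau>: "0 < \<tau>"
  shows "AE x in unit_lborel. \<forall>\<epsilon>>0. \<forall>\<^sub>F L in sequentially.
     real (N L) powr (\<tau> - \<epsilon>) < real (N L) * discrepancy (\<lambda>n. frac (of_int (a n) * x)) (N L)"
    (is "AE x in _. \<forall>\<epsilon>>0. ?large \<epsilon> x")
proof -
  have "AE x in unit_lborel. \<forall>k. ?large (inverse (real (Suc k))) x"
    unfolding AE_all_countable
    by (intro allI AE_eventually_discrepancy_gt_powr[OF growth N sparse L1 \<tau>]) auto
  then show ?thesis
  proof eventually_elim
    case (elim x)
    show ?case
    proof (intro allI impI)
      fix \<epsilon> :: real assume "0 < \<epsilon>"
      then obtain k where k: "inverse (real (Suc k)) < \<epsilon>" using reals_Archimedean by blast
      show "?large \<epsilon> x"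
        using elim[rule_format, of k] eventually_compose_filterlim[OF eventually_ge_at_top[of 1] N]
      proof eventually_elim
        case (elim L)
        have "real (N L) powr (\<tau> - \<epsilon>) \<le> real (N L) powr (\<tau> - inverse (real (Suc k)))"
          using k elim(2) by (intro powr_mono) auto
        then show ?case using elim(1) by linarith
      qed
    qed
  qed
qed

lemma filterlim_of_power_le:
  fixes b :: real and N :: "nat \<Rightarrow> nat"
  assumes "1 < b" "\<forall>\<^sub>F L in sequentially. b ^ L \<le> real (N L)"
  shows "filterlim N sequentially sequentially"
proof -
  have "filterlim (\<lambda>L. b ^ L) at_top sequentially" using assms(1) by real_asymp
  then show ?thesis
    unfolding filterlim_sequentially_iff_filterlim_real using assms(2) by (rule filterlim_at_top_mono)
qed

lemma summable_powr_of_power_le: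
  fixes b :: real and N :: "nat \<Rightarrow> nat"
  assumes "1 < b" "\<forall>\<^sub>F L in sequentially. b ^ L \<le> real (N L)" "0 < \<delta>"
  shows "summable (\<lambda>L. real (N L) powr - \<delta>)"
proof (rule summable_comparison_test_ev)
  show "\<forall>\<^sub>F L in sequentially. norm (real (N L) powr - \<delta>) \<le> (b powr - \<delta>) ^ L"
    using assms(2)
  proof eventually_elim
    case (elim L)
    then have "real (N L) powr - \<delta> \<le> (b ^ L) powr - \<delta>"
      using assms by (intro powr_mono2') auto
    then show ?case using assms(1) by (simp add: powr_realpow[symmetric] powr_powr powr_power mult_ac)
  qed
  have "b powr - \<delta> < 1" using assms powr_less_mono[of "- \<delta>" 0 b] by simp
  then show "summable (\<lambda>L. (b powr - \<delta>) ^ L)" by (intro summable_geometric) simp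
qed

lemma frequently_of_eventually_compose:
  assumes "filterlim f F G" "G \<noteq> bot" "\<forall>\<^sub>F x in G. P (f x)"
  shows "\<exists>\<^sub>F y in F. P y"
  using assms eventually_compose_filterlim[of "\<lambda>y. \<not> P y" F f G] eventually_frequently
  unfolding frequently_def by blast

theorem theorem3:
  fixes a :: "nat \<Rightarrow> int" and t :: nat and \<tau> B' B :: real and BL :: "nat \<Rightarrow> nat"
  assumes growth: "\<forall>\<^sub>F n in sequentially. \<bar>real_of_int (a n)\<bar> \<le> real n ^ t"
    and tau: "0 < \<tau>" "\<tau> < 1"
    and BB: "1 < B'" "B' < B"
    and BL_mono: "\<And>L M. 1 \<le> L \<Longrightarrow> L < M \<Longrightarrow> BL L < BL M"
    and BL_pos: "\<And>L. 1 \<le> L \<Longrightarrow> 0 < BL L"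
    and BL_bounds: "\<And>L. 1 \<le> L \<Longrightarrow> B' ^ L \<le> real (BL L) \<and> real (BL L) \<le> B ^ L"
    and integral_bound: "\<And>\<epsilon>. \<epsilon> > 0 \<Longrightarrow> \<forall>\<^sub>F L in sequentially.
        (LINT \<alpha>:{0..1}|lborel.
           norm (\<Sum>n=1..BL L. exp (2 * pi * \<i> * complex_of_real (real_of_int (a n) * \<alpha>))))
          > real (BL L) powr (\<tau> - \<epsilon>)"
  shows "AE \<alpha> in lborel. \<alpha> \<in> {0..<1} \<longrightarrow>
           (\<forall>\<epsilon>>0. \<exists>\<^sub>F N in sequentially.
              real N * discrepancy (\<lambda>n. frac (real_of_int (a n) * \<alpha>)) N > real N powr (\<tau> - \<epsilon>))"
proof -
  have BL_ge: "\<forall>\<^sub>F L in sequentially. B' ^ L \<le> real (BL L)"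
    using eventually_ge_at_top[of 1] by eventually_elim (use BL_bounds in blast)
  note BL_lim = filterlim_of_power_le[OF BB(1) BL_ge]
  have L1: "\<forall>\<^sub>F L in sequentially. real (BL L) powr (\<tau> - \<epsilon>) < weyl_L1_norm a (BL L)" if "0 < \<epsilon>" for \<epsilon>
    using integral_bound[OF that] by (simp only: weyl_L1_norm_eq_set_lebesgue_integral)
  have "AE \<alpha> in unit_lborel. \<forall>\<epsilon>>0. \<forall>\<^sub>F L in sequentially.
      real (BL L) powr (\<tau> - \<epsilon>) < real (BL L) * discrepancy (\<lambda>n. frac (of_int (a n) * \<alpha>)) (BL L)"
    by (rule AE_eventually_discrepancy_gt
        [OF growth BL_lim summable_powr_of_power_le[OF BB(1) BL_ge] L1 tau(1)])
  then have "AE \<alpha> in lborel. \<alpha> \<in> {0..1} \<longrightarrow> (\<forall>\<epsilon>>0. \<forall>\<^sub>F L in sequentially.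
      real (BL L) powr (\<tau> - \<epsilon>) < real (BL L) * discrepancy (\<lambda>n. frac (of_int (a n) * \<alpha>)) (BL L))"
    by (simp add: AE_restrict_space_iff)
  then show ?thesis
    by eventually_elim (auto intro: frequently_of_eventually_compose[OF BL_lim])
qed

end
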